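(* Let $A\subset\mathbb{N}$ and let $n\in\mathbb{N}$ be such that $n$ is not an odd prime, $S(n)\subset A$, $n\notin A$, and $\sigma(n)\ge 2n-d_0-1$, where $d_0=\inf(A\setminus D(n))$ (with $\inf\emptyset=+\infty$). Then $A\prec A\cup\{n\}$.
   Context: For $n\in\mathbb{N}$, $D(n)$ is the set of positive divisors of $n$, $S(n)=D(n)\setminus\{n\}$ is the set of proper divisors, and $\sigma(n)$ is the sum of all positive divisors. For $A\subset\mathbb{N}$, $S_A=\sum_{a\in A}a$ ($S_\emptyset=0$, $S_A=+\infty$ for infinite $A$), and $A$ is a practical set if every non-negative integer $k\le S_A$ is a sum of distinct elements of $A$. A number $m\in\mathbb{N}$ is $A$-practical if $D(m)\cap A$ is a practical set, and $\Pr(A)$ is the set of all $A$-practical numbers. For $A,A'\subset\mathbb{N}$, $A\prec A'$ means $A\subseteq A'$ and $\Pr(A)\subseteq\Pr(A')$. *)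

theory Defs
  imports "HOL-Library.Extended_Real" "HOL-Computational_Algebra.Primes"
begin

text \<open>
  The natural numbers of the source are the positive integers. Subsets are modelled
  as values of type \<^typ>\<open>nat set\<close> not containing \<open>0\<close>. The argument of
  \<open>divisors\<close> and \<open>sigma\<close> is meant to be positive.
\<close>

definition divisors :: "nat \<Rightarrow> nat set" where
  "divisors n = {d. d dvd n}"

definition proper_divisors :: "nat \<Rightarrow> nat set" where
  "proper_divisors n = divisors n - {n}"

definition sigma :: "nat \<Rightarrow> nat" where
  "sigma n = \<Sum>(divisors n)"

definition set_sum :: "nat set \<Rightarrow> enat" where
  "set_sum A = (if finite A then enat (\<Sum>A) else \<infinity>)"

definition practical_set :: "nat set \<Rightarrow> bool" where
  "practical_set A \<longleftrightarrow>
     (\<forall>k::nat. enat k \<le> set_sum A \<longrightarrow> (\<exists>B. finite B \<and> B \<subseteq> A \<and> \<Sum>B = k))"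

definition Pr :: "nat set \<Rightarrow> nat set" where
  "Pr A = {m. m > 0 \<and> practical_set (divisors m \<inter> A)}"

definition practical_prec :: "nat set \<Rightarrow> nat set \<Rightarrow> bool"  (infix "\<prec>" 50) where
  "A \<prec> A' \<longleftrightarrow> A \<subseteq> A' \<and> Pr A \<subseteq> Pr A'"

end

theory Submission imports Defs begin

text \<open>
  Adjoining a number \<open>n\<close> to a finite practical set \<open>B\<close> keeps it practical as soon as
  \<open>n \<le> \<Sum>B + 1\<close>. For \<open>B = divisors m \<inter> A\<close> with \<open>n\<close> dividing \<open>m\<close>, this bound is the
  hypothesis on \<open>sigma n\<close> if \<open>B\<close> contains a non-divisor of \<open>n\<close>. Otherwise \<open>B\<close> consists of
  the proper divisors of \<open>n\<close>; being practical forces \<open>2 \<in> B\<close>, so \<open>n\<close> is even, and the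
  representation of \<open>n/2 - 1\<close> together with the divisor \<open>n/2\<close> gives \<open>\<Sum>B \<ge> n - 1\<close>.
\<close>

lemma practical_set_finite_iff:
  assumes "finite B"
  shows "practical_set B \<longleftrightarrow> (\<forall>k\<le>\<Sum>B. \<exists>C\<subseteq>B. \<Sum>C = k)"
  using assms unfolding practical_set_def set_sum_def
  by (auto dest: finite_subset)

lemma practical_set_insert:
  assumes "finite B" "n \<notin> B" "practical_set B" "n \<le> \<Sum>B + 1"
  shows "practical_set (insert n B)"
proof -
  have rep: "\<exists>C\<subseteq>B. \<Sum>C = k" if "k \<le> \<Sum>B" for k
    using assms(1,3) that by (simp add: practical_set_finite_iff)
  have "\<exists>C\<subseteq>insert n B. \<Sum>C = k" if k: "k \<le> \<Sum>(insert n B)" for k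
  proof (cases "k \<le> \<Sum>B")
    case True
    then show ?thesis using rep by blast
  next
    case False
    then have "n \<le> k" "k - n \<le> \<Sum>B"
      using assms k by auto
    then obtain C where C: "C \<subseteq> B" "\<Sum>C = k - n"
      using rep by blast
    then have "\<Sum>(insert n C) = k"
      using assms(1,2) \<open>n \<le> k\<close> by (subst sum.insert) (auto dest: finite_subset)
    then show ?thesis using C by blast
  qed
  then show ?thesis
    using assms(1) by (simp add: practical_set_finite_iff)
qed

lemma finite_divisors: "n > 0 \<Longrightarrow> finite (divisors n)"
  by (simp add: divisors_def)

text \<open>Distinct positive integers with sum 2 cannot all equal 1, since a set holds 1 only once.
  A summand above 1 is at most the sum, hence equals 2.\<close>

lemma practical_set_two_mem:
  assumes "finite B" "0 \<notin> B" "practical_set B" "2 \<le> \<Sum>B"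
  shows "2 \<in> B"
proof -
  obtain C where C: "C \<subseteq> B" "\<Sum>C = 2"
    using assms by (auto simp: practical_set_finite_iff)
  then have fin: "finite C" using assms(1) finite_subset by blast
  have "\<exists>c\<in>C. c \<noteq> 1 \<and> c \<noteq> 0"
  proof (rule ccontr)
    assume "\<not> ?thesis"
    then have "C \<subseteq> {0, 1}" by blast
    then have "\<Sum>C \<le> \<Sum>{0, 1}" by (intro sum_mono2) auto
    then show False using C by simp
  qed
  then obtain c where c: "c \<in> C" "c \<ge> 2"
    by (metis One_nat_def Suc_leI le_neq_implies_less neq0_conv numeral_2_eq_2)
  moreover have "c \<le> \<Sum>C" using member_le_sum[of c C id] c fin by simp
  ultimately show ?thesis using C by auto
qed

lemma practical_proper_divisors_sum:
  assumes n: "n > 0" "\<not> (prime n \<and> odd n)" and pr: "practical_set (proper_divisors n)"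
  shows "n \<le> \<Sum>(proper_divisors n) + 1"
proof (cases "n \<le> 2")
  case True
  \<comment> \<open>For \<open>n = 1\<close> the sum is empty and the \<open>+ 1\<close> suffices;
    \<open>n = 2\<close> needs the divisor 1.\<close>
  have "\<Sum>{1} \<le> \<Sum>(proper_divisors n)" if "n = 2"
    using that finite_divisors[OF n(1)]
    by (intro sum_mono2) (auto simp: proper_divisors_def divisors_def)
  then show ?thesis using True by (cases "n = 2") auto
next
  case False
  let ?S = "proper_divisors n"
  have fin: "finite ?S" using finite_divisors[OF n(1)] by (simp add: proper_divisors_def)
  have "even n"
  proof (rule ccontr)
    assume "odd n"
    then have "\<not> prime n" using n by blast
    \<comment> \<open>An odd composite has a proper divisor \<open>d\<close> above 1, so the sum
      reaches 2 and practicality makes 2 a divisor of an odd number.\<close>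
    then obtain d where d: "d dvd n" "d \<noteq> 1" "d \<noteq> n"
      using False by (auto simp: prime_nat_iff)
    then have "d \<in> ?S" "d > 0" using n by (auto simp: proper_divisors_def divisors_def)
    moreover from this have "d \<le> \<Sum>?S" using member_le_sum[of d ?S id] fin by simp
    ultimately have "2 \<le> \<Sum>?S" using d by linarith
    moreover have "0 \<notin> ?S" using n by (auto simp: proper_divisors_def divisors_def)
    ultimately have "2 \<in> ?S" using practical_set_two_mem pr fin by blast
    then show False using \<open>odd n\<close> by (simp add: proper_divisors_def divisors_def)
  qed
  then obtain h where h: "n = 2 * h" by blast
  have hS: "h \<in> ?S" using h n by (auto simp: proper_divisors_def divisors_def)
  then have "h \<le> \<Sum>?S" using member_le_sum[of h ?S id] fin by simp
  \<comment> \<open>The target is \<open>h - 1\<close> rather than \<open>h\<close> so that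
    \<open>h\<close> is too large to occur in \<open>C\<close>; adding it then gives
    \<open>2 * h - 1 = n - 1\<close>.\<close>
  then have "h - 1 \<le> \<Sum>?S" by simp
  then obtain C where C: "C \<subseteq> ?S" "\<Sum>C = h - 1"
    using pr fin by (auto simp: practical_set_finite_iff)
  have finC: "finite C" using C fin finite_subset by blast
  have "h \<notin> C"
  proof
    assume "h \<in> C"
    then have "h \<le> \<Sum>C" using member_le_sum[of h C id] finC by simp
    then show False using C h n by simp
  qed
  then have "\<Sum>(insert h C) = h + (h - 1)" using C finC by simp
  moreover have "\<Sum>(insert h C) \<le> \<Sum>?S" using C hS fin by (intro sum_mono2) auto
  ultimately show ?thesis using h by simp
qed

theorem theorem3p12:
  fixes A :: "nat set" and n :: nat and d0 :: ereal
  assumes "0 \<notin> A" and "n > 0"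
    and "\<not> (prime n \<and> odd n)"
    and "proper_divisors n \<subseteq> A"
    and "n \<notin> A"
    and "d0 = (INF a\<in>A - divisors n. ereal (real a))"
    and "ereal (real (sigma n)) \<ge> 2 * ereal (real n) - d0 - 1"
  shows "A \<prec> A \<union> {n}"
proof -
  let ?S = "proper_divisors n"
  have finD: "finite (divisors n)" and finS: "finite ?S"
    using finite_divisors assms(2) by (auto simp: proper_divisors_def)
  have sigma: "sigma n = n + \<Sum>?S"
    unfolding sigma_def proper_divisors_def
    by (rule sum.remove) (use finD in \<open>auto simp: divisors_def\<close>)
  have "m \<in> Pr (A \<union> {n})" if m: "m \<in> Pr A" for m
  proof (cases "n dvd m")
    case False
    then have "divisors m \<inter> (A \<union> {n}) = divisors m \<inter> A" by (auto simp: divisors_def)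
    then show ?thesis using m by (simp add: Pr_def)
  next
    case True
    define B where "B = divisors m \<inter> A"
    have "m > 0" and pr: "practical_set B" using m by (auto simp: Pr_def B_def)
    have finB: "finite B" using finite_divisors[OF \<open>m > 0\<close>] by (simp add: B_def)
    have SB: "?S \<subseteq> B"
      using assms(4) True by (auto simp: B_def proper_divisors_def divisors_def)
    have nB: "n \<notin> B" using assms(5) by (simp add: B_def)
    have "n \<le> \<Sum>B + 1"
    proof (cases "B = ?S")
      case True
      then show ?thesis using practical_proper_divisors_sum assms(2,3) pr by simp
    next
      case False
      then obtain a where a: "a \<in> B" "a \<notin> ?S" using SB by blast
      \<comment> \<open>Since \<open>n\<close> is not in \<open>B\<close>, an element of
        \<open>B\<close> that is no proper divisor of \<open>n\<close> is no divisor at all, so it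
        bounds \<open>d0\<close> from above.\<close>
      then have aA: "a \<in> A - divisors n"
        using nB by (auto simp: B_def proper_divisors_def)
      then have "d0 \<le> ereal (real a)" unfolding assms(6) by (rule INF_lower)
      \<comment> \<open>Together with the upper bound \<open>a\<close> this makes \<open>d0\<close>
        finite, so the hypothesis becomes an inequality of reals; replacing \<open>d0\<close> by the
        possibly larger \<open>a\<close> only weakens it.\<close>
      moreover have "0 \<le> d0" unfolding assms(6) by (rule INF_greatest) simp
      ultimately have "2 * real n - real a - 1 \<le> real (sigma n)"
        using assms(7) by (cases d0) (auto simp: one_ereal_def)
      then have "n \<le> a + \<Sum>?S + 1" unfolding sigma by linarith
      also have "a + \<Sum>?S = \<Sum>(insert a ?S)" using a finS by simp
      also have "\<dots> \<le> \<Sum>B" using a SB finB by (intro sum_mono2) auto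
      finally show ?thesis by simp
    qed
    then have "practical_set (insert n B)" using practical_set_insert finB nB pr by blast
    moreover have "divisors m \<inter> (A \<union> {n}) = insert n B"
      using True by (auto simp: B_def divisors_def)
    ultimately show ?thesis using \<open>m > 0\<close> by (simp add: Pr_def)
  qed
  then show ?thesis by (auto simp: practical_prec_def)
qed

end
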